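(* Let $\mu_n$ ($n\ge 0$) be the Taylor coefficients of the entire function $s(s-1)\zeta(s)$ at $s=1$, i.e. $s(s-1)\zeta(s)=\sum_{n=0}^{\infty}\mu_n(s-1)^n$. Then for every integer $n\ge 0$, $$\mu_n=\frac{2}{n!}\int_{0}^{\infty}\mu(t)\,\mathrm{Re}\big\{(a-\log t)^{n}\big\}\,dt.$$
   Context: $\zeta$ denotes the Riemann zeta function. Define for $t>0$ $$\mu(t)=\frac{d^2}{dt^2}\frac{te^{-t}}{1-e^{-t}}=-\frac{(2+t)e^{t}}{(e^{t}-1)^2}+\frac{2te^{2t}}{(e^{t}-1)^3},$$ and let $a=\log(2\pi)+i\frac{\pi}{2}$; $\log t$ is the real logarithm. *)

theory Defs
  imports "HOL-Analysis.Analysis"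
begin

text \<open>The entire function s(s-1)zeta(s): the unique entire function that agrees with
  s(s-1) times the Dirichlet series of the Riemann zeta function on the half-plane Re s > 1
  (uniqueness by the identity theorem; this is the analytic continuation).\<close>
definition xi_entire :: "complex \<Rightarrow> complex" where
  "xi_entire = (THE F. F holomorphic_on UNIV \<and>
      (\<forall>s. 1 < Re s \<longrightarrow> F s = s * (s - 1) * (\<Sum>n. 1 / (of_nat (Suc n)) powr s)))"

definition mu_coeff :: "nat \<Rightarrow> complex" where
  "mu_coeff n = (deriv ^^ n) xi_entire 1 / fact n"

definition mu_fun :: "real \<Rightarrow> real" where
  "mu_fun t = - ((2 + t) * exp t) / (exp t - 1)^2 + 2 * t * exp (2 * t) / (exp t - 1)^3"

definition a_const :: complex where
  "a_const = complex_of_real (ln (2 * pi)) + \<i> * complex_of_real (pi / 2)"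

end

theory Submission
  imports Defs "HOL-Complex_Analysis.Complex_Analysis"
begin

text \<open>The partial fraction expansion of \<open>t / (exp t - 1)\<close>, differentiated twice, writes
  \<open>\<mu>(t)\<close> as the sum over \<open>k \<ge> 1\<close> of \<open>q(t / c) / c\<^sup>2\<close> with \<open>c = 2 \<pi> k\<close> and
  \<open>q(u) = 4 (1 - 3 u\<^sup>2) / (1 + u\<^sup>2)\<^sup>3\<close>. For real \<open>w\<close> strictly between 0 and 1, termwise integration
  against \<open>t powr (-w)\<close> gives \<open>(2 \<pi>) powr (-w - 1)\<close> times \<open>\<zeta>(1 + w)\<close> times the Mellin integral
  of \<open>q\<close>, which is a difference of Beta integrals and equals \<open>w (w + 1) \<pi> / cos (\<pi> w / 2)\<close>.
  Hence \<open>w (w + 1) \<zeta>(1 + w)\<close> is the integral of \<open>\<mu>(t) * 2 Re (exp (w (a - ln t)))\<close>. This integral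
  is holomorphic in \<open>Re w < 1\<close> after replacing \<open>2 Re\<close> by the sum over \<open>a\<close> and its conjugate, so
  gluing it to the Dirichlet series yields the entire function itself; no other proof of the
  continuation of zeta is needed. Expanding the exponential under the integral sign gives its
  Taylor coefficients at \<open>s = 1\<close>.\<close>

section \<open>Partial fractions\<close>

lemma sin_pi_times_nonzero:
  fixes z :: complex
  assumes "z \<notin> \<int>"
  shows "sin (of_real pi * z) \<noteq> 0"
proof
  assume "sin (of_real pi * z) = 0"
  then obtain n :: int where "of_real pi * z = of_real (of_int n * pi)"
    by (auto simp: sin_eq_0)
  then have "z = of_int n" by simp
  with assms show False by simp
qed

lemma one_minus_not_Ints:
  fixes z :: complex
  assumes "z \<notin> \<int>"
  shows "1 - z \<notin> \<int>"
proof
  assume "1 - z \<in> \<int>"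
  then have "1 - (1 - z) \<in> \<int>" by (rule Ints_diff[OF Ints_1])
  with assms show False by (simp only: diff_diff_eq2 add_diff_cancel_left')
qed

text \<open>Both sides are the logarithmic derivative of \<open>Gamma z * Gamma (1 - z)\<close>,
  which also equals \<open>pi / sin (pi * z)\<close>.\<close>

lemma Digamma_reflection:
  fixes z :: complex
  assumes z: "z \<notin> \<int>"
  shows "Digamma z - Digamma (1 - z) = - of_real pi * cot (of_real pi * z)"
proof -
  have nz: "z \<notin> \<int>\<^sub>\<le>\<^sub>0" "1 - z \<notin> \<int>\<^sub>\<le>\<^sub>0"
    using z one_minus_not_Ints[OF z] nonpos_Ints_subset_Ints by blast+
  have sn: "sin (of_real pi * z) \<noteq> 0"
    using z by (rule sin_pi_times_nonzero)
  have "((\<lambda>w. Gamma w * Gamma (1 - w)) has_field_derivative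
      Gamma z * Gamma (1 - z) * (Digamma z - Digamma (1 - z))) (at z)"
    using nz by (auto intro!: derivative_eq_intros simp: algebra_simps)
  moreover have "((\<lambda>w. of_real pi / sin (of_real pi * w)) has_field_derivative
      (of_real pi / sin (of_real pi * z)) * (- of_real pi * cot (of_real pi * z))) (at z)"
    using sn by (auto intro!: derivative_eq_intros simp: cot_def field_simps power2_eq_square)
  ultimately have "Gamma z * Gamma (1 - z) * (Digamma z - Digamma (1 - z)) =
     Gamma z * Gamma (1 - z) * (- of_real pi * cot (of_real pi * z))"
    unfolding Gamma_reflection_complex by (rule DERIV_unique)
  moreover have "Gamma z * Gamma (1 - z) \<noteq> 0"
    using nz by (simp add: Gamma_eq_zero_iff)
  ultimately show ?thesis
    by (metis mult_left_cancel)
qed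

text \<open>Differentiating a reflection formula raises the order by one, and the inner derivative
  of \<open>1 - w\<close> turns \<open>c\<close> into \<open>-c\<close>. Starting from the digamma
  case with \<open>c = -1\<close>, two applications give orders 1 and 2.\<close>

lemma Polygamma_reflection_step:
  fixes f g :: "complex \<Rightarrow> complex"
  assumes "\<And>w. w \<notin> \<int> \<Longrightarrow> Polygamma n w + c * Polygamma n (1 - w) = f w"
    and "(f has_field_derivative D) (at z)" and z: "z \<notin> \<int>"
  shows "Polygamma (Suc n) z - c * Polygamma (Suc n) (1 - z) = D"
proof -
  have nz: "z \<notin> \<int>\<^sub>\<le>\<^sub>0" "1 - z \<notin> \<int>\<^sub>\<le>\<^sub>0"
    using z one_minus_not_Ints[OF z] nonpos_Ints_subset_Ints by blast+
  have "((\<lambda>w. Polygamma n w + c * Polygamma n (1 - w)) has_field_derivative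
      Polygamma (Suc n) z - c * Polygamma (Suc n) (1 - z)) (at z)"
    using nz by (auto intro!: derivative_eq_intros)
  moreover have "open (- \<int> :: complex set)"
    by (simp add: closed_Ints open_Compl)
  ultimately have "(f has_field_derivative Polygamma (Suc n) z - c * Polygamma (Suc n) (1 - z)) (at z)"
    by (rule has_field_derivative_transform_within_open) (use assms in auto)
  then show ?thesis
    using assms(2) by (rule DERIV_unique)
qed

lemma Polygamma_1_reflection:
  fixes z :: complex
  assumes z: "z \<notin> \<int>"
  shows "Polygamma 1 z + Polygamma 1 (1 - z) = of_real pi ^ 2 / sin (of_real pi * z) ^ 2"
proof -
  have sn: "sin (of_real pi * z) \<noteq> 0"
    using z by (rule sin_pi_times_nonzero)
  have "Polygamma (Suc 0) z - (-1) * Polygamma (Suc 0) (1 - z) = of_real pi ^ 2 / sin (of_real pi * z) ^ 2"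
  proof (rule Polygamma_reflection_step[OF _ _ z])
    show "Digamma w + (-1) * Digamma (1 - w) = - of_real pi * cot (of_real pi * w)" if "w \<notin> \<int>" for w :: complex
      using Digamma_reflection[OF that] by simp
    show "((\<lambda>w. - of_real pi * cot (of_real pi * w)) has_field_derivative
        of_real pi ^ 2 / sin (of_real pi * z) ^ 2) (at z)"
      using sn by (auto intro!: derivative_eq_intros DERIV_chain2[OF DERIV_cot] simp: field_simps power2_eq_square)
  qed
  then show ?thesis by simp
qed

lemma Polygamma_2_reflection:
  fixes z :: complex
  assumes z: "z \<notin> \<int>"
  shows "Polygamma 2 z - Polygamma 2 (1 - z) =
    - 2 * of_real pi ^ 3 * cos (of_real pi * z) / sin (of_real pi * z) ^ 3"
proof -
  have sn: "sin (of_real pi * z) \<noteq> 0"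
    using z by (rule sin_pi_times_nonzero)
  have "Polygamma (Suc 1) z - 1 * Polygamma (Suc 1) (1 - z) =
      - 2 * of_real pi ^ 3 * cos (of_real pi * z) / sin (of_real pi * z) ^ 3"
    by (rule Polygamma_reflection_step[where f = "\<lambda>z. of_real pi ^ 2 / sin (of_real pi * z) ^ 2"])
      (use Polygamma_1_reflection sn z in \<open>auto intro!: derivative_eq_intros simp: field_simps power2_eq_square power3_eq_cube\<close>)
  then show ?thesis by (simp add: numeral_2_eq_2)
qed

text \<open>The second derivative of \<open>2 * u\<^sup>2 / (1 + u\<^sup>2)\<close>, the building block of the partial
  fraction expansion of \<open>t / (exp t - 1)\<close>.\<close>
definition q_ker :: "real \<Rightarrow> real" where
  "q_ker u = 4 * (1 - 3 * u\<^sup>2) / (1 + u\<^sup>2) ^ 3"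

text \<open>At this \<open>z\<close>,
  \<open>t / (exp t - 1) = pi * z * cot (pi * z) - t / 2\<close>, and two derivatives in
  \<open>t\<close> amount to \<open>-1 / (4 * pi^2)\<close> times two derivatives in
  \<open>z\<close>. The derivatives of the cotangent are then polygamma values by the reflection
  formulas.\<close>

lemma mu_fun_polygamma:
  assumes t: "t > 0" and z: "z = \<i> * of_real (t / (2 * pi))"
  shows "of_real (mu_fun t) = (2 * (Polygamma 1 z + Polygamma 1 (1 - z))
    + z * (Polygamma 2 z - Polygamma 2 (1 - z))) / (4 * of_real pi ^ 2)"
proof -
  have zi: "z \<notin> \<int>"
    using t z by (auto elim!: Ints_cases simp: complex_eq_iff)
  \<comment> \<open>Since \<open>pi * z = i * t / 2\<close>, sine and cosine of
    \<open>pi * z\<close> are rational functions of \<open>exp (t/2)\<close>, so the claim becomes a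
    rational identity in \<open>E\<close> and \<open>Q\<close>.\<close>
  define E where "E = complex_of_real (exp (t/2))"
  have E0: "E \<noteq> 0" by (simp add: E_def)
  have EX: "E\<^sup>2 = of_real (exp t)"
    by (simp add: E_def flip: of_real_power exp_double)
  define Q where "Q = E\<^sup>2 - 1"
  have Q: "Q = of_real (exp t - 1)"
    by (simp add: Q_def EX)
  have Q0: "Q \<noteq> 0"
    unfolding Q using t by (simp only: of_real_eq_0_iff) simp
  have piz: "of_real pi * z = \<i> * of_real (t/2)"
    by (simp add: z)
  have ee: "exp (of_real t / 2) = E"
    by (simp add: E_def flip: exp_of_real)
  have ee': "exp (- (of_real t / 2)) = 1 / E"
    by (simp add: exp_minus ee field_simps)
  have s: "sin (of_real pi * z) = \<i> * Q / (2 * E)"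
    unfolding piz sin_exp_eq using E0 by (simp add: ee ee' Q_def field_simps power2_eq_square)
  have c: "cos (of_real pi * z) = (E\<^sup>2 + 1) / (2 * E)"
    unfolding piz cos_exp_eq using E0 by (simp add: ee ee' field_simps power2_eq_square)
  have s2: "1 / sin (of_real pi * z) ^ 2 = - 4 * E\<^sup>2 / Q\<^sup>2"
    unfolding s by (simp add: power_divide power_mult_distrib)
  have i3: "\<i> ^ 3 = - \<i>"
    by (simp add: power3_eq_cube)
  have s3: "cos (of_real pi * z) / sin (of_real pi * z) ^ 3 = 4 * \<i> * E\<^sup>2 * (E\<^sup>2 + 1) / Q ^ 3"
    unfolding s c using E0 Q0
    by (simp add: power_divide power_mult_distrib i3 field_simps)
       (simp add: power_numeral_reduce)
  have e2: "exp (2 * t) = exp t ^ 2"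
    by (simp add: exp_double)
  have "of_real (mu_fun t) = - ((2 + of_real t) * E\<^sup>2) / Q\<^sup>2 + 2 * of_real t * (E\<^sup>2)\<^sup>2 / Q ^ 3"
    unfolding EX Q mu_fun_def e2 by simp
  also have "\<dots> = - 2 * E\<^sup>2 / Q\<^sup>2 + of_real t * E\<^sup>2 * (E\<^sup>2 + 1) / Q ^ 3"
  proof -
    have "E\<^sup>2 = Q + 1" by (simp add: Q_def)
    then show ?thesis
      using Q0 by (simp add: field_simps power2_eq_square power3_eq_cube)
  qed
  also have "\<dots> = (2 * (of_real pi ^ 2 * (- 4 * E\<^sup>2 / Q\<^sup>2))
    + (of_real pi * z) * (- 2 * of_real pi ^ 2 * (4 * \<i> * E\<^sup>2 * (E\<^sup>2 + 1) / Q ^ 3))) / (4 * of_real pi ^ 2)"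
    unfolding piz by (simp add: add_divide_distrib diff_divide_distrib)
  finally show ?thesis
    unfolding Polygamma_1_reflection[OF zi] Polygamma_2_reflection[OF zi] s2[symmetric] s3[symmetric]
    by (simp add: power2_eq_square power3_eq_cube mult_ac)
qed

text \<open>The polygamma values are expanded into their series at \<open>z\<close> and
  \<open>1 - z\<close>. The poles at \<open>-m\<close> and \<open>m\<close> pair up for each
  \<open>m \<ge> 1\<close>, and as \<open>z\<close> is purely imaginary each pair has a real sum, a
  rescaled \<open>q_ker\<close>.\<close>

lemma mu_fun_sums:
  assumes t: "t > 0"
  shows "(\<lambda>k. q_ker (t / (2 * pi * Suc k)) / (2 * pi * Suc k) ^ 2) sums mu_fun t"
proof -
  define z where "z = \<i> * of_real (t / (2 * pi))"
  have zi: "z \<notin> \<int>"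
    using t by (auto elim!: Ints_cases simp: complex_eq_iff z_def)
  have zi': "1 - z \<notin> \<int>"
    using zi by (rule one_minus_not_Ints)
  have nz: "w + of_nat k \<noteq> 0" if "w \<notin> \<int>" for w :: complex and k
    using that by (metis Ints_minus Ints_of_nat add_eq_0_iff2)
  have P1: "(\<lambda>k. inverse ((w + of_nat k)^2)) sums Polygamma 1 w" if "w \<notin> \<int>" for w :: complex
    using Polygamma_LIMSEQ[of w 1] that Ints_0 by (force simp: numeral_2_eq_2)
  have P2: "(\<lambda>k. -2 * inverse ((w + of_nat k)^3)) sums Polygamma 2 w" if "w \<notin> \<int>" for w :: complex
    using sums_mult[OF Polygamma_LIMSEQ[of w 2], of "-2"] that Ints_0 by (force simp: numeral_3_eq_3)
  \<comment> \<open>With \<open>w = z + k, v = z\<close> the numerator is \<open>2 * k\<close>; with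
    \<open>w = 1 - z + k, v = -z\<close> it is \<open>2 * (k + 1)\<close>.\<close>
  have comb: "2 * inverse (w ^ 2) + v * (-2 * inverse (w ^ 3)) = 2 * (w - v) / w ^ 3" if "w \<noteq> 0" for v w :: complex
    using that by (simp add: field_simps power2_eq_square power3_eq_cube)
  have "(\<lambda>k. 2 * inverse ((z + of_nat k)^2) + z * (-2 * inverse ((z + of_nat k)^3))) sums
     (2 * Polygamma 1 z + z * Polygamma 2 z)"
    by (intro sums_add sums_mult P1 P2 zi)
  also have "(\<lambda>k. 2 * inverse ((z + of_nat k)^2) + z * (-2 * inverse ((z + of_nat k)^3))) =
     (\<lambda>k. 2 * of_nat k / (z + of_nat k)^3)"
    using comb[OF nz[OF zi]] by auto
  \<comment> \<open>The term at \<open>k = 0\<close> vanishes, so the index shifts for free and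
    matches that of the series at \<open>1 - z\<close>.\<close>
  finally have "(\<lambda>k. 2 * of_nat (Suc k) / (z + of_nat (Suc k))^3) sums (2 * Polygamma 1 z + z * Polygamma 2 z)"
    by (subst sums_Suc_iff) auto
  moreover have "(\<lambda>k. 2 * inverse ((1 - z + of_nat k)^2) - z * (-2 * inverse ((1 - z + of_nat k)^3))) sums
     (2 * Polygamma 1 (1 - z) - z * Polygamma 2 (1 - z))"
    by (intro sums_diff sums_mult P1 P2 zi')
  moreover have "(\<lambda>k. 2 * inverse ((1 - z + of_nat k)^2) - z * (-2 * inverse ((1 - z + of_nat k)^3))) =
     (\<lambda>k. 2 * of_nat (Suc k) / (of_nat (Suc k) - z)^3)"
  proof
    fix k
    show "2 * inverse ((1 - z + of_nat k)^2) - z * (-2 * inverse ((1 - z + of_nat k)^3)) =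
     2 * of_nat (Suc k) / (of_nat (Suc k) - z)^3"
      using comb[OF nz[OF zi'], of k "-z"] by (simp add: algebra_simps)
  qed
  ultimately have "(\<lambda>k. 2 * of_nat (Suc k) / (z + of_nat (Suc k))^3 + 2 * of_nat (Suc k) / (of_nat (Suc k) - z)^3) sums
     (2 * Polygamma 1 z + z * Polygamma 2 z + (2 * Polygamma 1 (1 - z) - z * Polygamma 2 (1 - z)))"
    by (intro sums_add) auto
  then have S: "(\<lambda>k. (2 * of_nat (Suc k) / (z + of_nat (Suc k))^3 + 2 * of_nat (Suc k) / (of_nat (Suc k) - z)^3) / (4 * of_real pi ^ 2)) sums
     of_real (mu_fun t)"
    unfolding mu_fun_polygamma[OF t z_def] by (intro sums_divide) (simp add: algebra_simps)
  have "(2 * of_nat (Suc k) / (z + of_nat (Suc k))^3 + 2 * of_nat (Suc k) / (of_nat (Suc k) - z)^3) / (4 * of_real pi ^ 2) =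
     complex_of_real (q_ker (t / (2 * pi * Suc k)) / (2 * pi * Suc k) ^ 2)" for k
  proof -
    define y m where "y = t / (2 * pi)" and "m = real (Suc k)"
    have m: "m > 0" by (simp add: m_def)
    have y: "y\<^sup>2 + m\<^sup>2 > 0" using m by (simp add: add_nonneg_pos)
    have zy: "z = \<i> * of_real y" by (simp add: z_def y_def)
    have n: "of_nat (Suc k) = complex_of_real m" by (simp add: m_def)
    have "(of_real m - z) * (z + of_real m) = of_real (y\<^sup>2 + m\<^sup>2)"
      by (simp add: zy algebra_simps power2_eq_square)
    moreover have "z + of_real m \<noteq> 0" "of_real m - z \<noteq> 0"
      using m by (auto simp: zy complex_eq_iff)
    ultimately have "2 * of_real m / (z + of_real m)^3 + 2 * of_real m / (of_real m - z)^3 =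
       2 * of_real m * ((of_real m - z)^3 + (z + of_real m)^3) / of_real (y\<^sup>2 + m\<^sup>2)^3"
      by (simp add: field_simps flip: power_mult_distrib)
    also have "(of_real m - z)^3 + (z + of_real m)^3 = of_real (2 * m ^ 3 - 6 * m * y\<^sup>2)"
      by (simp add: zy power2_eq_square power3_eq_cube algebra_simps)
    also have "2 * complex_of_real m * of_real (2 * m ^ 3 - 6 * m * y\<^sup>2) / of_real (y\<^sup>2 + m\<^sup>2)^3 =
        of_real (2 * m * (2 * m ^ 3 - 6 * m * y\<^sup>2) / (y\<^sup>2 + m\<^sup>2)^3)" by simp
    also have "2 * m * (2 * m ^ 3 - 6 * m * y\<^sup>2) / (y\<^sup>2 + m\<^sup>2)^3 = q_ker (y / m) / m\<^sup>2"
    proof -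
      have "q_ker (y / m) / m\<^sup>2 = 4 * (m\<^sup>2 - 3 * y\<^sup>2) / m ^ 4 / ((y\<^sup>2 + m\<^sup>2) / m\<^sup>2) ^ 3"
        using m by (simp add: q_ker_def field_simps power_numeral_reduce)
      also have "\<dots> = 4 * (m\<^sup>2 - 3 * y\<^sup>2) * m\<^sup>2 / (y\<^sup>2 + m\<^sup>2) ^ 3"
      proof -
        have "a / m ^ 4 / (D / m\<^sup>2) ^ 3 = a * m\<^sup>2 / D ^ 3" if "D > 0" for a D
          using m that by (simp add: power_divide field_simps power_numeral_reduce)
        then show ?thesis using y by blast
      qed
      finally show ?thesis by (simp add: power_numeral_reduce algebra_simps)
    qed
    finally have "2 * of_real m / (z + of_real m)^3 + 2 * of_real m / (of_real m - z)^3 =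
        complex_of_real (q_ker (y / m) / m\<^sup>2)" .
    moreover have "q_ker (t / (2 * pi * m)) / (2 * pi * m)\<^sup>2 = q_ker (y / m) / m\<^sup>2 / (4 * pi\<^sup>2)"
      by (simp add: y_def power_mult_distrib)
    ultimately show ?thesis
      unfolding n m_def[symmetric] by simp
  qed
  with S have "(\<lambda>k. complex_of_real (q_ker (t / (2 * pi * Suc k)) / (2 * pi * Suc k) ^ 2)) sums of_real (mu_fun t)"
    by simp
  then show ?thesis by (simp only: sums_of_real_iff)
qed

section \<open>Mellin integrals\<close>

lemma set_integrable_lborel_iff_absolutely:
  fixes f :: "real \<Rightarrow> 'a :: euclidean_space"
  assumes "f \<in> borel_measurable borel" "S \<in> sets borel"
  shows "set_integrable lborel S f \<longleftrightarrow> f absolutely_integrable_on S"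
  unfolding set_integrable_def
  using assms by (subst integrable_completion) auto

text \<open>Substitute \<open>x = u^2 / (1 + u^2)\<close> in the Beta integral: this maps the
  positive axis bijectively onto the open unit interval, with \<open>1 - x = 1 / (1 + u^2)\<close>
  and \<open>dx = 2 * u / (1 + u^2)^2 du\<close>.\<close>

lemma Beta_integral_lborel:
  assumes p: "p > 0" and r: "r > (0 :: real)"
  shows "set_integrable lborel {0<..} (\<lambda>u. u powr (2 * p - 1) / (1 + u\<^sup>2) powr (p + r))"
    and "(LBINT u:{0<..}. u powr (2 * p - 1) / (1 + u\<^sup>2) powr (p + r)) = Beta p r / 2"
proof -
  let ?f = "\<lambda>x::real. x powr (p - 1) * (1 - x) powr (r - 1)"
  let ?g = "\<lambda>u::real. u\<^sup>2 / (1 + u\<^sup>2)"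
  let ?g' = "\<lambda>u::real. 2 * u / (1 + u\<^sup>2)\<^sup>2"
  let ?k = "\<lambda>u. u powr (2 * p - 1) / (1 + u\<^sup>2) powr (p + r)"
  have pos: "1 + u\<^sup>2 > 0" for u :: real
    by (simp add: add_pos_nonneg)
  have img: "?g ` {0<..} = {0<..<1}"
  proof (intro equalityI subsetI)
    fix x :: real assume x: "x \<in> {0<..<1}"
    then have "x = ?g (sqrt (x / (1 - x)))" by (simp add: field_simps)
    moreover have "sqrt (x / (1 - x)) \<in> {0<..}" using x by simp
    ultimately show "x \<in> ?g ` {0<..}" by (rule image_eqI)
  qed (use pos in \<open>auto simp: field_simps\<close>)
  have inj: "inj_on ?g {0<..}"
  proof (rule inj_onI)
    fix x y :: real assume "x \<in> {0<..}" "y \<in> {0<..}" "?g x = ?g y"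
    then show "x = y" using pos[of x] pos[of y] by (simp add: field_simps power2_eq_iff)
  qed
  have der: "(?g has_field_derivative ?g' u) (at u within {0<..})" for u
    using pos[of u] by (auto intro!: derivative_eq_intros simp: field_simps power2_eq_square)
  have "set_integrable lborel {0..1} ?f"
    using integrable_Beta[OF p r] .
  then have "set_integrable lborel {0<..<1} ?f"
    by (rule set_integrable_subset) auto
  then have "?f absolutely_integrable_on {0<..<1}"
    by (subst (asm) set_integrable_lborel_iff_absolutely) auto
  moreover have "integral {0<..<1} ?f = Beta p r"
    using has_integral_Beta_real[OF p r] by (auto simp: has_integral_Icc_iff_Ioo)
  ultimately have *: "(\<lambda>u. \<bar>?g' u\<bar> * ?f (?g u)) absolutely_integrable_on {0<..} \<and>
      integral {0<..} (\<lambda>u. \<bar>?g' u\<bar> * ?f (?g u)) = Beta p r"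
    by (subst has_absolute_integral_change_of_variables_1'[OF _ der inj]) (simp_all add: img)
  have eq: "\<bar>?g' u\<bar> * ?f (?g u) = 2 * ?k u" if "u > 0" for u
  proof -
    have "1 - ?g u = 1 / (1 + u\<^sup>2)" using pos[of u] by (simp add: field_simps)
    moreover have "\<bar>?g' u\<bar> = 2 * u / (1 + u\<^sup>2) powr 2"
      using that pos[of u] by (simp add: powr_numeral)
    ultimately have "\<bar>?g' u\<bar> * ?f (?g u) = 2 * (u powr 1 * (u powr 2) powr (p - 1)) /
        ((1 + u\<^sup>2) powr 2 * (1 + u\<^sup>2) powr (p - 1) * (1 + u\<^sup>2) powr (r - 1))"
      using that pos[of u] by (simp add: powr_divide powr_numeral)
    also have "\<dots> = 2 * ?k u"
      unfolding powr_powr powr_add[symmetric] by (simp add: algebra_simps)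
    finally show ?thesis .
  qed
  have "set_integrable lborel {0<..} (\<lambda>u. 2 * ?k u)"
  proof (subst set_integrable_lborel_iff_absolutely)
    have "(\<lambda>u. \<bar>?g' u\<bar> * ?f (?g u)) absolutely_integrable_on {0<..} \<longleftrightarrow>
        (\<lambda>u. 2 * ?k u) absolutely_integrable_on {0<..}"
      by (rule set_integrable_cong[OF refl refl], rule eq) simp
    with * show "(\<lambda>u. 2 * ?k u) absolutely_integrable_on {0<..}" by blast
  qed auto
  from set_integrable_mult_right[OF this, of "1 / 2"] show i: "set_integrable lborel {0<..} ?k"
    by simp
  have "(LBINT u:{0<..}. ?k u) = integral {0<..} ?k"
    using i by (rule set_borel_integral_eq_integral)
  moreover have "integral {0<..} (\<lambda>u. \<bar>?g' u\<bar> * ?f (?g u)) = integral {0<..} (\<lambda>u. 2 * ?k u)"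
    by (rule integral_cong, rule eq) simp
  then have "2 * integral {0<..} ?k = Beta p r"
    using * unfolding integral_mult_right by simp
  ultimately show "(LBINT u:{0<..}. ?k u) = Beta p r / 2" by simp
qed

lemma Gamma_reflection_real:
  fixes x :: real
  shows "Gamma x * Gamma (1 - x) = pi / sin (pi * x)"
proof -
  have "complex_of_real (Gamma x * Gamma (1 - x)) = of_real (pi / sin (pi * x))"
    unfolding of_real_mult of_real_divide Gamma_complex_of_real[symmetric] sin_of_real[symmetric]
    using Gamma_reflection_complex[of "of_real x"] by simp
  then show ?thesis by (simp only: of_real_eq_iff)
qed

text \<open>With \<open>D = 1 + u^2\<close> the kernel is \<open>16 / D^3 - 12 / D^2\<close>, so the
  integral is a combination of two Beta integrals. The recurrence of Gamma reduces both to
  \<open>Gamma p * Gamma (1 - p)\<close>, which the reflection formula evaluates.\<close>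

lemma q_ker_mellin:
  assumes w: "0 < w" "w < 1"
  shows "set_integrable lborel {0<..} (\<lambda>u. u powr (-w) * q_ker u)"
    and "(LBINT u:{0<..}. u powr (-w) * q_ker u) = w * (w + 1) * pi / cos (pi * w / 2)"
proof -
  \<comment> \<open>This choice makes \<open>u powr (-w)\<close> equal to
    \<open>u powr (2 * p - 1)\<close>; the second Beta parameters \<open>3 - p\<close> and
    \<open>2 - p\<close> then produce the powers \<open>D^3\<close> and \<open>D^2\<close>.\<close>
  define p where "p = (1 - w) / 2"
  have p: "0 < p" "p < 1" using w by (auto simp: p_def)
  have wp: "-w = 2 * p - 1" by (simp add: p_def field_simps)
  let ?k = "\<lambda>r u. u powr (2 * p - 1) / (1 + u\<^sup>2) powr (p + r)"
  have pos: "1 + u\<^sup>2 > 0" for u :: real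
    by (simp add: add_pos_nonneg)
  have eq: "u powr (-w) * q_ker u = 16 * ?k (3 - p) u - 12 * ?k (2 - p) u" for u
  proof -
    have "4 * (1 - 3 * (D - 1)) / D ^ 3 = 16 / D ^ 3 - 12 / D\<^sup>2" if "D > 0" for D :: real
      using that by (simp add: field_simps power2_eq_square power3_eq_cube)
    from this[OF pos[of u]] have Q: "q_ker u = 16 / (1 + u\<^sup>2) ^ 3 - 12 / (1 + u\<^sup>2)\<^sup>2"
      by (simp add: q_ker_def)
    then show ?thesis
      unfolding wp Q using pos[of u] by (simp add: powr_numeral right_diff_distrib mult.commute)
  qed
  have p32: "3 - p > 0" "2 - p > 0" using p by auto
  note i = Beta_integral_lborel(1)[OF p(1) p32(1)] Beta_integral_lborel(1)[OF p(1) p32(2)]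
  note I = Beta_integral_lborel(2)[OF p(1) p32(1)] Beta_integral_lborel(2)[OF p(1) p32(2)]
  show "set_integrable lborel {0<..} (\<lambda>u. u powr (-w) * q_ker u)"
    unfolding eq using i by (intro set_integral_diff(1) set_integrable_mult_right) auto
  have ni: "x \<notin> \<int>\<^sub>\<le>\<^sub>0" if "x > 0" for x :: real
    using that by (auto elim!: nonpos_Ints_cases)
  have G2: "Gamma (2 - p) = (1 - p) * Gamma (1 - p)"
    using Gamma_plus1[OF ni[of "1 - p"]] p by simp
  have G3: "Gamma (3 - p) = (2 - p) * ((1 - p) * Gamma (1 - p))"
    using Gamma_plus1[OF ni[of "2 - p"]] p unfolding G2[symmetric] by simp
  have F: "Gamma (3::real) = 2" "Gamma (2::real) = 1"
    using Gamma_fact[of 2, where 'a = real] Gamma_fact[of 1, where 'a = real] by auto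
  have "(LBINT u:{0<..}. u powr (-w) * q_ker u) = 16 * (LBINT u:{0<..}. ?k (3 - p) u) - 12 * (LBINT u:{0<..}. ?k (2 - p) u)"
    unfolding eq set_integral_diff(2)[OF set_integrable_mult_right[OF i(1)] set_integrable_mult_right[OF i(2)]]
    by (simp only: set_integral_mult_right)
  also have "\<dots> = (1 - p) * (2 - 4 * p) * (Gamma p * Gamma (1 - p))"
    unfolding I Beta_def G2 G3 by (simp add: F field_simps)
  also have "\<dots> = w * (w + 1) * (pi / sin (pi * p))"
  proof -
    have "(1 - p) * (2 - 4 * p) = w * (w + 1)"
      by (simp add: p_def field_simps)
    then show ?thesis
      unfolding Gamma_reflection_real by simp
  qed
  also have "sin (pi * p) = cos (pi * w / 2)"
    by (simp add: p_def cos_sin_eq field_simps)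
  finally show "(LBINT u:{0<..}. u powr (-w) * q_ker u) = w * (w + 1) * pi / cos (pi * w / 2)" by simp
qed

text \<open>A crude uniform bound is enough to compare the partial fraction series with the sum of
  \<open>12 / (2 * pi * k)^2\<close>.\<close>

lemma abs_q_ker_le: "\<bar>q_ker u\<bar> \<le> 12"
proof -
  have D: "1 + u\<^sup>2 \<ge> 1" by simp
  have "\<bar>1 - 3 * u\<^sup>2\<bar> \<le> 3 * (1 + u\<^sup>2) ^ 1"
    by (simp add: abs_le_iff)
  also have "\<dots> \<le> 3 * (1 + u\<^sup>2) ^ 3"
    using D by (intro mult_left_mono power_increasing) auto
  finally have "\<bar>4 * (1 - 3 * u\<^sup>2)\<bar> \<le> 12 * \<bar>(1 + u\<^sup>2) ^ 3\<bar>"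
    unfolding abs_mult using D by simp
  then show ?thesis
    unfolding q_ker_def abs_divide using D by (subst pos_divide_le_eq) (auto intro!: zero_less_power add_pos_nonneg)
qed

section \<open>Termwise Mellin transform of \<open>mu_fun\<close> and the zeta series\<close>

lemma summable_inverse_powr_Suc:
  assumes "x > (1 :: real)"
  shows "summable (\<lambda>k. 1 / real (Suc k) powr x)"
proof -
  have "summable (\<lambda>k. real k powr (-x))"
    using assms by (subst summable_real_powr_iff) auto
  then have "summable (\<lambda>k. real (Suc k) powr (-x))"
    by (subst summable_Suc_iff)
  then show ?thesis
    by (simp only: powr_minus_divide)
qed

lemma summable_inverse_square_scaled: "summable (\<lambda>k. 1 / (2 * pi * real (Suc k))\<^sup>2)"
proof -
  have "summable (\<lambda>k. 1 / (2 * pi)\<^sup>2 * inverse (real (Suc k) ^ 2))"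
    using inverse_power_summable[of 2, where 'a = real] by (intro summable_mult, subst summable_Suc_iff) simp
  moreover have "1 / (2 * pi)\<^sup>2 * inverse (real (Suc k) ^ 2) = 1 / (2 * pi * real (Suc k))\<^sup>2" for k
    by (simp only: power_mult_distrib inverse_mult_distrib divide_inverse mult_1_left mult.assoc)
  ultimately show ?thesis by (simp only:)
qed

text \<open>Substitute \<open>t = c * u\<close>: the factors \<open>c powr (-w)\<close>,
  \<open>1 / c^2\<close> and \<open>dt = c du\<close> combine to
  \<open>c powr (-(w + 1))\<close>.\<close>

lemma mellin_scale:
  fixes f :: "real \<Rightarrow> real" and c w :: real
  assumes c: "c > 0"
  shows "set_integrable lborel {0<..} (\<lambda>t. t powr (-w) * (f (t / c) / c\<^sup>2)) \<longleftrightarrow>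
      set_integrable lborel {0<..} (\<lambda>u. u powr (-w) * f u)" (is ?A)
    and "(LBINT t:{0<..}. t powr (-w) * (f (t / c) / c\<^sup>2)) =
      c powr (-(w + 1)) * (LBINT u:{0<..}. u powr (-w) * f u)" (is ?B)
proof -
  \<comment> \<open>Extension by zero to the whole line allows the affine substitution;
    \<open>c > 0\<close> preserves the positive axis.\<close>
  define F where "F t = indicator {0<..} t *\<^sub>R (t powr (-w) * (f (t / c) / c\<^sup>2))" for t
  define G where "G u = indicator {0<..} u *\<^sub>R (u powr (-w) * f u)" for u
  have eq: "F (0 + c * u) = c powr (-(w + 2)) * G u" for u
  proof (cases "u > 0")
    case True
    have "c powr (-(w + 2)) = c powr (-w) / c\<^sup>2"
      using c by (simp add: powr_diff powr_numeral)
    then show ?thesis using True c by (simp add: F_def G_def powr_mult)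
  next
    case False
    then show ?thesis using c by (simp add: F_def G_def mult_pos_neg zero_less_mult_iff)
  qed
  have "integrable lborel F \<longleftrightarrow> integrable lborel G"
    using lborel_integrable_real_affine_iff[of c F 0] c unfolding eq by simp
  then show ?A
    by (simp add: set_integrable_def F_def[abs_def] G_def[abs_def])
  have "integral\<^sup>L lborel F = c * (c powr (-(w + 2)) * integral\<^sup>L lborel G)"
    using lborel_integral_real_affine[of c F 0] c unfolding eq by simp
  also have "c * (c powr (-(w + 2)) * integral\<^sup>L lborel G) = c powr 1 * c powr (-(w + 2)) * integral\<^sup>L lborel G"
    using c by simp
  also have "\<dots> = c powr (-(w + 1)) * integral\<^sup>L lborel G"
    unfolding powr_add[symmetric] by (simp add: algebra_simps)
  finally show ?B
    by (simp add: set_lebesgue_integral_def F_def[abs_def] G_def[abs_def])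
qed

text \<open>Each partial fraction contributes \<open>c k powr (-(w + 1))\<close> times the Mellin
  integral of \<open>q_ker\<close>, and summing over \<open>k\<close> gives the zeta series. Sum and
  integral may be exchanged because \<open>w + 1 > 1\<close>.\<close>

lemma mu_fun_mellin_zeta:
  assumes w: "0 < w" "w < 1"
  shows "(LBINT t:{0<..}. t powr (-w) * mu_fun t) =
      (2 * pi) powr (-(w + 1)) * (w * (w + 1) * pi / cos (pi * w / 2)) * (\<Sum>k. 1 / real (Suc k) powr (w + 1))"
proof -
  define c where "c k = 2 * pi * real (Suc k)" for k
  have c: "c k > 0" for k by (simp add: c_def)
  define f where "f k t = indicator {0<..} t *\<^sub>R (t powr (-w) * (q_ker (t / c k) / (c k)\<^sup>2))" for k t
  have q: "set_integrable lborel {0<..} (\<lambda>u. u powr (-w) * q_ker u)"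
    using q_ker_mellin(1)[OF w] .
  have ck: "c k powr (-(w + 1)) = (2 * pi) powr (-(w + 1)) * (1 / real (Suc k) powr (w + 1))" for k
    unfolding c_def powr_minus_divide[of "real (Suc k)", symmetric] by (subst powr_mult) auto
  have sz: "summable (\<lambda>k. 1 / real (Suc k) powr (w + 1))"
    using w by (intro summable_inverse_powr_Suc) simp
  have i: "integrable lborel (f k)" for k
    using q mellin_scale(1)[where c = "c k" and w = w and f = q_ker, OF c] by (simp add: set_integrable_def f_def[abs_def])
  have I: "integral\<^sup>L lborel (f k) = c k powr (-(w + 1)) * (LBINT u:{0<..}. u powr (-w) * q_ker u)" for k
    using mellin_scale(2)[where c = "c k" and w = w and f = q_ker, OF c] by (simp add: set_lebesgue_integral_def f_def[abs_def])
  \<comment> \<open>The scaling law for the absolute value of \<open>q_ker\<close> shows that the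
    norms of the terms have the same dependence on \<open>k\<close>, hence a summable one.\<close>
  have N: "(\<integral>t. norm (f k t) \<partial>lborel) = c k powr (-(w + 1)) * (LBINT u:{0<..}. u powr (-w) * \<bar>q_ker u\<bar>)" for k
    using mellin_scale(2)[where c = "c k" and w = w and f = "\<lambda>u. \<bar>q_ker u\<bar>", OF c]
    by (simp add: set_lebesgue_integral_def f_def[abs_def] abs_mult)
  have nf: "norm (f k t) \<le> t powr (-w) * (12 * (1 / (c k)\<^sup>2))" for k t
    using abs_q_ker_le[of "t / c k"] c[of k]
    by (auto simp: f_def indicator_def abs_mult intro!: mult_left_mono divide_right_mono)
  have "summable (\<lambda>k. norm (f k t))" for t
    by (rule summable_comparison_test'[OF summable_mult[OF summable_mult[OF summable_inverse_square_scaled]]])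
       (use nf c_def in auto)
  then have ae: "AE t in lborel. summable (\<lambda>k. norm (f k t))" by simp
  have sN: "summable (\<lambda>k. \<integral>t. norm (f k t) \<partial>lborel)"
    unfolding N ck by (intro summable_mult2 summable_mult sz)
  have sf: "(\<Sum>k. f k t) = indicator {0<..} t *\<^sub>R (t powr (-w) * mu_fun t)" for t
  proof (cases "t > 0")
    case True
    show ?thesis
      unfolding f_def c_def using True sums_mult[OF mu_fun_sums[OF True], of "t powr (-w)"]
      by (simp add: sums_iff)
  qed (simp add: f_def)
  have "(LBINT t:{0<..}. t powr (-w) * mu_fun t) = (\<Sum>k. integral\<^sup>L lborel (f k))"
    using integral_suminf[OF i ae sN] by (simp add: sf set_lebesgue_integral_def)
  also have "\<dots> = (2 * pi) powr (-(w + 1)) * (\<Sum>k. 1 / real (Suc k) powr (w + 1)) * (w * (w + 1) * pi / cos (pi * w / 2))"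
    unfolding I ck q_ker_mellin(2)[OF w] suminf_mult[OF sz, symmetric]
    by (rule suminf_mult2[OF summable_mult[OF sz], symmetric])
  finally show "(LBINT t:{0<..}. t powr (-w) * mu_fun t) =
      (2 * pi) powr (-(w + 1)) * (w * (w + 1) * pi / cos (pi * w / 2)) * (\<Sum>k. 1 / real (Suc k) powr (w + 1))"
    by (simp only: mult_ac)
qed

section \<open>Decay of the weight and exponential transforms\<close>

lemma borel_measurable_mu_fun [measurable]: "mu_fun \<in> borel_measurable borel"
  unfolding mu_fun_def[abs_def] by measurable

text \<open>In the closed form the poles at \<open>t = 0\<close> cancel, which is awkward to
  estimate; the partial fraction series is bounded uniformly in \<open>t\<close> term by
  term.\<close>

lemma mu_fun_bounded:
  obtains C where "\<And>t. t > 0 \<Longrightarrow> \<bar>mu_fun t\<bar> \<le> C"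
proof
  fix t :: real
  assume t: "t > 0"
  let ?g = "\<lambda>k. 12 * (1 / (2 * pi * real (Suc k))\<^sup>2)"
  have g: "summable ?g"
    by (intro summable_mult summable_inverse_square_scaled)
  have le: "norm (q_ker (t / (2 * pi * Suc k)) / (2 * pi * Suc k) ^ 2) \<le> ?g k" for k
    using abs_q_ker_le[of "t / (2 * pi * Suc k)"] by (simp add: divide_right_mono)
  have "norm (\<Sum>k. q_ker (t / (2 * pi * Suc k)) / (2 * pi * Suc k) ^ 2) \<le> suminf ?g"
    by (rule norm_suminf_le[OF le g])
  then show "\<bar>mu_fun t\<bar> \<le> suminf ?g"
    using mu_fun_sums[OF t] by (simp add: sums_iff)
qed

text \<open>For \<open>t \<ge> 1\<close>, \<open>exp t \<ge> 2\<close>, so \<open>exp t - 1\<close>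
  may be replaced by \<open>exp t / 2\<close> in the denominators. The two terms then add up to
  \<open>(8 + 20 * t) / exp t\<close>.\<close>

lemma mu_fun_decay_ge_1:
  assumes t: "t \<ge> 1"
  shows "\<bar>mu_fun t\<bar> \<le> 20 * (1 + t) * exp (-t)"
proof -
  define E where "E = exp t"
  have E2: "E \<ge> 2"
    using exp_ge_add_one_self[of t] t unfolding E_def by linarith
  have b: "\<bar>a / (E - 1) ^ n\<bar> \<le> a / (E / 2) ^ n" if "a \<ge> 0" for a n
    using that E2 by (auto simp: abs_div intro!: divide_left_mono power_mono mult_pos_pos zero_less_power)
  have e: "mu_fun t = 2 * t * E\<^sup>2 / (E - 1) ^ 3 - (2 + t) * E / (E - 1) ^ 2"
    by (simp add: mu_fun_def E_def exp_double)
  have "\<bar>mu_fun t\<bar> \<le> \<bar>2 * t * E\<^sup>2 / (E - 1) ^ 3\<bar> + \<bar>(2 + t) * E / (E - 1) ^ 2\<bar>"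
    unfolding e by (rule abs_triangle_ineq4)
  also have "\<dots> \<le> 2 * t * E\<^sup>2 / (E / 2) ^ 3 + (2 + t) * E / (E / 2) ^ 2"
    using t E2 by (intro add_mono b) auto
  also have "\<dots> = (8 + 20 * t) / E"
    using E2 by (simp add: field_simps power2_eq_square power3_eq_cube)
  also have "\<dots> \<le> 20 * (1 + t) / E"
    using E2 by (intro divide_right_mono) auto
  finally show ?thesis by (simp add: E_def exp_minus divide_inverse)
qed

lemma mu_fun_decay:
  obtains C where "C \<ge> 0" "\<And>t. t > 0 \<Longrightarrow> \<bar>mu_fun t\<bar> \<le> C * ((1 + t) * exp (-t))"
proof -
  obtain K where K: "\<And>t. t > 0 \<Longrightarrow> \<bar>mu_fun t\<bar> \<le> K"
    using mu_fun_bounded by blast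
  have K0: "K \<ge> 0" using K[of 1] by linarith
  show ?thesis
  \<comment> \<open>The summand 20 serves \<open>t \<ge> 1\<close>; below 1 the bound
    \<open>K\<close> is absorbed by \<open>1 \<le> 3 * exp (-t)\<close>.\<close>
  proof (rule that[of "20 + 3 * K"])
    fix t :: real
    assume t: "t > 0"
    show "\<bar>mu_fun t\<bar> \<le> (20 + 3 * K) * ((1 + t) * exp (-t))"
    proof (cases "t \<ge> 1")
      case True
      have "20 * (1 + t) * exp (-t) \<le> (20 + 3 * K) * ((1 + t) * exp (-t))"
        unfolding mult.assoc using True K0 by (intro mult_right_mono) auto
      with mu_fun_decay_ge_1[OF True] show ?thesis by (rule order_trans)
    next
      case False
      have "exp t \<le> 3"
        using False exp_le by (metis exp_le_cancel_iff le_cases order_trans)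
      then have "1 \<le> 3 * exp (-t)"
        by (simp add: exp_minus field_simps)
      also have "\<dots> \<le> 3 * ((1 + t) * exp (-t))"
        using t by (intro mult_left_mono) (auto simp: algebra_simps)
      finally have "K * 1 \<le> K * (3 * ((1 + t) * exp (-t)))"
        using K0 by (intro mult_left_mono)
      also have "\<dots> \<le> (20 + 3 * K) * ((1 + t) * exp (-t))"
        using t by (simp add: algebra_simps)
      finally show ?thesis using K[OF t] by simp
    qed
  qed (use K0 in auto)
qed

lemma set_integrable_powr_exp:
  assumes s: "s > (-1 :: real)"
  shows "set_integrable lborel {0<..} (\<lambda>t. t powr s * exp (-t))"
proof -
  have "(\<lambda>t. complex_of_real t powr (of_real (s + 1) - 1) / of_real (exp t)) absolutely_integrable_on {0<..}"
    using s by (intro absolutely_integrable_Gamma_integral') simp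
  then have "(\<lambda>t. norm (complex_of_real t powr (of_real (s + 1) - 1) / of_real (exp t))) absolutely_integrable_on {0<..}"
    by (rule set_integrable_norm)
  also have "?this \<longleftrightarrow> (\<lambda>t. t powr s * exp (-t)) absolutely_integrable_on {0<..}"
    by (rule set_integrable_cong) (auto simp: norm_mult norm_inverse norm_powr_real_powr exp_minus divide_inverse)
  finally show ?thesis
    by (subst set_integrable_lborel_iff_absolutely) auto
qed

text \<open>Boundedness near 0 allows any exponent above -1, and exponential decay handles infinity.
  This threshold is the source of the half-plane \<open>Re w < 1\<close> below.\<close>

lemma set_integrable_mu_fun_powr:
  assumes s: "s > (-1 :: real)"
  shows "set_integrable lborel {0<..} (\<lambda>t. mu_fun t * t powr s)"
proof -
  obtain C where C: "C \<ge> 0" "\<And>t. t > 0 \<Longrightarrow> \<bar>mu_fun t\<bar> \<le> C * ((1 + t) * exp (-t))"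
    using mu_fun_decay by blast
  have "set_integrable lborel {0<..} (\<lambda>t. C * (t powr s * exp (-t) + t powr (s + 1) * exp (-t)))"
    using s by (intro set_integrable_mult_right set_integral_add set_integrable_powr_exp) auto
  then show ?thesis
  proof (rule set_integrable_bound)
    show "AE t in lborel. t \<in> {0<..} \<longrightarrow> norm (mu_fun t * t powr s) \<le>
        norm (C * (t powr s * exp (-t) + t powr (s + 1) * exp (-t)))"
    proof (intro AE_I2 impI)
      fix t :: real assume "t \<in> {0<..}"
      then have t: "t > 0" by simp
      have "norm (mu_fun t * t powr s) \<le> C * ((1 + t) * exp (-t)) * t powr s"
        using C(2)[OF t] by (simp add: abs_mult mult_right_mono)
      also have "\<dots> = C * (t powr s * exp (-t) + t powr (s + 1) * exp (-t))"
        using t by (simp add: powr_add algebra_simps)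
      finally show "norm (mu_fun t * t powr s) \<le> norm (C * (t powr s * exp (-t) + t powr (s + 1) * exp (-t)))"
        by simp
    qed
  qed (simp add: set_borel_measurable_def)
qed

text \<open>Expand the exponential and integrate termwise. The assumed integrable function dominates
  every partial sum of the norms, so it bounds the sums of their integrals as well as each single
  term.\<close>

lemma exp_transform_sums:
  fixes G b :: "'a \<Rightarrow> complex"
  assumes [measurable]: "G \<in> borel_measurable M" "b \<in> borel_measurable M"
    and int: "integrable M (\<lambda>x. norm (G x) * exp (norm z * norm (b x)))"
  shows "(\<lambda>n. (\<integral>x. G x * b x ^ n \<partial>M) / fact n * z ^ n) sums (\<integral>x. G x * exp (z * b x) \<partial>M)"
    and "integrable M (\<lambda>x. G x * (z * b x) ^ n)"
proof -
  define f where "f n x = G x * ((z * b x) ^ n /\<^sub>R fact n)" for n x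
  have [measurable]: "f n \<in> borel_measurable M" for n
    unfolding f_def[abs_def] by measurable
  let ?y = "\<lambda>x. norm z * norm (b x)"
  have nf: "norm (f n x) = norm (G x) * (?y x ^ n /\<^sub>R fact n)" for n x
    by (simp add: f_def norm_mult norm_power)
  have part: "(\<Sum>k<n. norm (f k x)) \<le> norm (G x) * exp (?y x)" for n x
  proof -
    have "(\<Sum>k<n. ?y x ^ k /\<^sub>R fact k) \<le> exp (?y x)"
      unfolding exp_def by (rule sum_le_suminf[OF summable_exp_generic]) auto
    then show ?thesis
      unfolding nf sum_distrib_left[symmetric] by (rule mult_left_mono) simp
  qed
  have nle: "norm (f n x) \<le> norm (G x) * exp (?y x)" for n x
  proof -
    have "norm (f n x) \<le> (\<Sum>k<Suc n. norm (f k x))"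
      by (rule member_le_sum) auto
    with part[of x "Suc n"] show ?thesis by linarith
  qed
  have i: "integrable M (f n)" for n
    by (rule Bochner_Integration.integrable_bound[OF int]) (use nle in auto)
  then have "integrable M (\<lambda>x. fact n * f n x)"
    by (intro integrable_mult_right)
  moreover have "fact n * f n x = G x * (z * b x) ^ n" for x
    by (simp add: f_def scaleR_conv_of_real field_simps)
  ultimately show "integrable M (\<lambda>x. G x * (z * b x) ^ n)"
    by (simp only:)
  have ae: "AE x in M. summable (\<lambda>k. norm (f k x))"
    by (intro AE_I2) (unfold nf, intro summable_mult summable_exp_generic)
  have "(\<Sum>k<n. \<integral>x. norm (f k x) \<partial>M) \<le> (\<integral>x. norm (G x) * exp (?y x) \<partial>M)" for n
  proof -
    have "(\<Sum>k<n. \<integral>x. norm (f k x) \<partial>M) = (\<integral>x. (\<Sum>k<n. norm (f k x)) \<partial>M)"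
      using i by (subst Bochner_Integration.integral_sum) auto
    also have "\<dots> \<le> (\<integral>x. norm (G x) * exp (?y x) \<partial>M)"
      using i int part by (intro integral_mono) auto
    finally show ?thesis .
  qed
  then have s: "summable (\<lambda>k. \<integral>x. norm (f k x) \<partial>M)"
    by (intro summableI_nonneg_bounded[where x = "\<integral>x. norm (G x) * exp (?y x) \<partial>M"]) auto
  have "(\<lambda>n. integral\<^sup>L M (f n)) sums (\<integral>x. (\<Sum>n. f n x) \<partial>M)"
    using i ae s by (rule sums_integral)
  moreover have "(\<Sum>n. f n x) = G x * exp (z * b x)" for x
    unfolding f_def exp_def by (intro suminf_mult summable_exp_generic)
  moreover have "integral\<^sup>L M (f n) = (\<integral>x. G x * b x ^ n \<partial>M) / fact n * z ^ n" for n
  proof -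
    have "f n = (\<lambda>x. (z ^ n / fact n) * (G x * b x ^ n))"
      by (auto simp: f_def fun_eq_iff power_mult_distrib scaleR_conv_of_real divide_inverse)
    then show ?thesis by simp
  qed
  ultimately show "(\<lambda>n. (\<integral>x. G x * b x ^ n \<partial>M) / fact n * z ^ n) sums (\<integral>x. G x * exp (z * b x) \<partial>M)"
    by simp
qed

text \<open>Up to a constant the integrand is at most \<open>\<bar>mu_fun t\<bar>\<close> times
  \<open>t powr (- Re w + norm z) + t powr (- Re w - norm z)\<close>; the hypothesis keeps both
  exponents above -1.\<close>

lemma mu_fun_exp_integrable:
  fixes a w z :: complex
  assumes wz: "Re w + norm z < 1"
  shows "integrable lborel (\<lambda>t. norm (indicator {0<..} t *\<^sub>R (of_real (mu_fun t) * exp (w * (a - of_real (ln t))))) *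
      exp (norm z * norm (a - of_real (ln t))))"
proof -
  let ?r = "norm z"
  let ?K = "exp (Re (w * a) + ?r * norm a)"
  have "Re w - ?r < 1" using wz norm_ge_zero[of z] by linarith
  then have "set_integrable lborel {0<..} (\<lambda>t. ?K * (\<bar>mu_fun t * t powr (- Re w + ?r)\<bar> + \<bar>mu_fun t * t powr (- Re w - ?r)\<bar>))"
    using wz by (intro set_integrable_mult_right set_integral_add set_integrable_abs set_integrable_mu_fun_powr) auto
  then show ?thesis
    unfolding set_integrable_def
  proof (rule Bochner_Integration.integrable_bound)
    show "AE t in lborel. norm (norm (indicator {0<..} t *\<^sub>R (of_real (mu_fun t) * exp (w * (a - of_real (ln t))))) *
      exp (norm z * norm (a - of_real (ln t)))) \<le> norm (indicator {0<..} t *\<^sub>R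
        (?K * (\<bar>mu_fun t * t powr (- Re w + ?r)\<bar> + \<bar>mu_fun t * t powr (- Re w - ?r)\<bar>)))"
    proof (intro AE_I2)
      fix t :: real
      show "norm (norm (indicator {0<..} t *\<^sub>R (of_real (mu_fun t) * exp (w * (a - of_real (ln t))))) *
      exp (norm z * norm (a - of_real (ln t)))) \<le> norm (indicator {0<..} t *\<^sub>R
        (?K * (\<bar>mu_fun t * t powr (- Re w + ?r)\<bar> + \<bar>mu_fun t * t powr (- Re w - ?r)\<bar>)))"
      proof (cases "t > 0")
        case True
        have n: "norm (exp (w * (a - of_real (ln t)))) = exp (Re (w * a)) * t powr (- Re w)"
          using True unfolding norm_exp_eq_Re by (simp add: powr_def algebra_simps flip: exp_add)
        have "?r * norm (a - of_real (ln t)) \<le> ?r * (norm a + \<bar>ln t\<bar>)"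
          using norm_triangle_ineq4[of a "of_real (ln t)"] by (intro mult_left_mono) auto
        then have "exp (?r * norm (a - of_real (ln t))) \<le> exp (?r * norm a) * exp (?r * \<bar>ln t\<bar>)"
          by (simp add: algebra_simps flip: exp_add)
        \<comment> \<open>One of the two powers equals the left side, according to the sign of
          \<open>ln t\<close>.\<close>
        also have "exp (?r * \<bar>ln t\<bar>) \<le> t powr ?r + t powr (- ?r)"
          using True by (auto simp: powr_def abs_if)
        finally have e: "exp (?r * norm (a - of_real (ln t))) \<le> exp (?r * norm a) * (t powr ?r + t powr (- ?r))"
          by simp
        have "\<bar>mu_fun t\<bar> * (exp (Re (w * a)) * t powr (- Re w)) * exp (?r * norm (a - of_real (ln t))) \<le>
            \<bar>mu_fun t\<bar> * (exp (Re (w * a)) * t powr (- Re w)) * (exp (?r * norm a) * (t powr ?r + t powr (- ?r)))"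
          by (intro mult_left_mono e) auto
        also have "\<dots> = ?K * (\<bar>mu_fun t * t powr (- Re w + ?r)\<bar> + \<bar>mu_fun t * t powr (- Re w + - ?r)\<bar>)"
          unfolding powr_add exp_add abs_mult by (simp add: algebra_simps)
        finally show ?thesis
          unfolding norm_scaleR norm_mult n using True by simp
      qed simp
    qed
  qed measurable
qed

text \<open>With \<open>a = a_const\<close> and its conjugate, the sum of the two transforms at \<open>s - 1\<close> carries the
  factor \<open>2 * (2 * pi) powr (s - 1) * cos (pi * (s - 1) / 2)\<close> of the functional equation of zeta.\<close>
definition mu_transform :: "complex \<Rightarrow> complex \<Rightarrow> complex" where
  "mu_transform a w = (LBINT t:{0<..}. of_real (mu_fun t) * exp (w * (a - of_real (ln t))))"

definition mu_moment :: "complex \<Rightarrow> nat \<Rightarrow> complex" where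
  "mu_moment a n = (LBINT t:{0<..}. of_real (mu_fun t) * (a - of_real (ln t)) ^ n)"

text \<open>Split \<open>exp ((w + z) * b) = exp (w * b) * exp (z * b)\<close> with
  \<open>b = a - ln t\<close>; the first factor joins the weight and the second is expanded in
  \<open>z\<close>.\<close>

lemma mu_transform_sums_at:
  fixes a w z :: complex
  assumes "Re w + norm z < 1"
  shows "(\<lambda>n. (\<integral>t. indicator {0<..} t *\<^sub>R (of_real (mu_fun t) * exp (w * (a - of_real (ln t)))) *
      (a - of_real (ln t)) ^ n \<partial>lborel) / fact n * z ^ n) sums mu_transform a (w + z)"
proof -
  have "mu_transform a (w + z) = (\<integral>t. indicator {0<..} t *\<^sub>R (of_real (mu_fun t) * exp (w * (a - of_real (ln t)))) *
      exp (z * (a - of_real (ln t))) \<partial>lborel)"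
    unfolding mu_transform_def set_lebesgue_integral_def
    by (intro Bochner_Integration.integral_cong) (auto simp: distrib_right exp_add)
  with exp_transform_sums(1)[OF _ _ mu_fun_exp_integrable[OF assms, of a]] show ?thesis
    by simp
qed

text \<open>Around each \<open>w\<close> the transform is a power series on the largest disc inside
  the half-plane, so no differentiation under the integral is required.\<close>

lemma holomorphic_mu_transform: "mu_transform a holomorphic_on {w. Re w < 1}"
proof -
  have "mu_transform a holomorphic_on ball w (1 - Re w)" if "Re w < 1" for w
  proof (rule power_series_holomorphic)
    fix v assume "v \<in> ball w (1 - Re w)"
    then have "Re w + norm (v - w) < 1"
      by (simp add: dist_norm norm_minus_commute)
    from mu_transform_sums_at[OF this, of a]
    show "(\<lambda>n. (\<integral>t. indicator {0<..} t *\<^sub>R (of_real (mu_fun t) * exp (w * (a - of_real (ln t)))) *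
      (a - of_real (ln t)) ^ n \<partial>lborel) / fact n * (v - w) ^ n) sums mu_transform a v"
      by simp
  qed
  then have "mu_transform a field_differentiable (at w)" if "Re w < 1" for w
    by (rule holomorphic_on_imp_differentiable_at) (use that in auto)
  then show ?thesis
    by (simp add: holomorphic_on_def field_differentiable_at_within)
qed

lemma mu_transform_sums:
  assumes "norm z < 1"
  shows "(\<lambda>n. mu_moment a n / fact n * z ^ n) sums mu_transform a z"
  using mu_transform_sums_at[of 0 z a] assms
  by (simp add: mu_moment_def set_lebesgue_integral_def scaleR_conv_of_real mult.assoc)

lemma set_integrable_mu_moment:
  "set_integrable lborel {0<..} (\<lambda>t. of_real (mu_fun t) * (a - of_real (ln t)) ^ n :: complex)"
proof -
  \<comment> \<open>The point \<open>1/2\<close> is just a nonzero value within the radius of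
    convergence; multiplication by \<open>2 ^ n\<close> then removes it from the integrand.\<close>
  have "Re 0 + norm (1/2 :: complex) < 1" by simp
  from exp_transform_sums(2)[OF _ _ mu_fun_exp_integrable[OF this, of a], of n]
  have "integrable lborel (\<lambda>t. indicator {0<..} t *\<^sub>R (of_real (mu_fun t) * exp (0 * (a - of_real (ln t)))) *
      (1/2 * (a - of_real (ln t))) ^ n)"
    by simp
  then have "integrable lborel (\<lambda>t. 2 ^ n * (indicator {0<..} t *\<^sub>R (of_real (mu_fun t) * exp (0 * (a - of_real (ln t)))) *
      (1/2 * (a - of_real (ln t))) ^ n))"
    by (rule integrable_mult_right)
  moreover have "2 ^ n * (indicator {0<..} t *\<^sub>R (of_real (mu_fun t) * exp (0 * (a - of_real (ln t)))) *
      (1/2 * (a - of_real (ln t))) ^ n) = indicator {0<..} t *\<^sub>R (of_real (mu_fun t) * (a - of_real (ln t)) ^ n)" for t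
    by (simp add: power_mult_distrib scaleR_conv_of_real power_divide)
  ultimately show ?thesis
    unfolding set_integrable_def by (simp only:)
qed

text \<open>As \<open>mu_fun t\<close> and \<open>ln t\<close> are real, the two integrands are
  conjugate and add up to twice the real part.\<close>

lemma mu_moment_cnj_add:
  "mu_moment a n + mu_moment (cnj a) n =
    of_real (2 * (LBINT t:{0<..}. mu_fun t * Re ((a - of_real (ln t)) ^ n)))"
proof -
  have "mu_moment a n + mu_moment (cnj a) n =
      (LBINT t:{0<..}. of_real (mu_fun t) * (a - of_real (ln t)) ^ n + of_real (mu_fun t) * (cnj a - of_real (ln t)) ^ n)"
    unfolding mu_moment_def by (intro set_integral_add(2)[symmetric] set_integrable_mu_moment)
  also have "\<dots> = (LBINT t:{0<..}. of_real (2 * (mu_fun t * Re ((a - of_real (ln t)) ^ n))))"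
  proof (rule set_lebesgue_integral_cong, simp, intro allI impI)
    fix t :: real
    have "(cnj a - of_real (ln t)) ^ n = cnj ((a - of_real (ln t)) ^ n)" by simp
    then show "of_real (mu_fun t) * (a - of_real (ln t)) ^ n + of_real (mu_fun t) * (cnj a - of_real (ln t)) ^ n =
        complex_of_real (2 * (mu_fun t * Re ((a - of_real (ln t)) ^ n)))"
      by (simp only: distrib_left[symmetric] complex_add_cnj) simp
  qed
  also have "\<dots> = of_real (LBINT t:{0<..}. 2 * (mu_fun t * Re ((a - of_real (ln t)) ^ n)))"
    unfolding set_lebesgue_integral_def
    by (subst integral_complex_of_real[symmetric]) (simp add: scaleR_conv_of_real)
  also have "(LBINT t:{0<..}. 2 * (mu_fun t * Re ((a - of_real (ln t)) ^ n))) =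
      2 * (LBINT t:{0<..}. mu_fun t * Re ((a - of_real (ln t)) ^ n))"
    by (rule set_integral_mult_right)
  finally show ?thesis .
qed

text \<open>The exponentials at \<open>a_const\<close> and its conjugate add up to
  \<open>2 * (2 * pi) powr w * cos (pi * w / 2) * t powr (-w)\<close>; this constant cancels the
  cosine and the powers of \<open>2 * pi\<close> in the Mellin transform of
  \<open>mu_fun\<close>.\<close>

lemma mu_transform_add_real:
  assumes w: "0 < w" "w < 1"
  shows "mu_transform a_const (of_real w) + mu_transform (cnj a_const) (of_real w) =
    of_real (w * (w + 1) * (\<Sum>k. 1 / real (Suc k) powr (w + 1)))"
proof -
  let ?c = "2 * (2 * pi) powr w * cos (pi * w / 2)"
  have i: "set_integrable lborel {0<..} (\<lambda>t. of_real (mu_fun t) * exp (of_real w * (a - of_real (ln t))) :: complex)" for a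
  proof -
    \<comment> \<open>With \<open>z = 0\<close> and power 0 the general integrability statement is
      that of the transform itself.\<close>
    have "Re (of_real w) + norm (0 :: complex) < 1" using w by simp
    from exp_transform_sums(2)[OF _ _ mu_fun_exp_integrable[OF this, of a], of 0]
    show ?thesis by (simp add: set_integrable_def)
  qed
  have cospos: "cos (pi * w / 2) > 0"
  proof (rule cos_gt_zero_pi)
    show "- (pi / 2) < pi * w / 2" using w pi_gt_zero by (smt (verit) divide_pos_pos mult_pos_pos)
    show "pi * w / 2 < pi / 2" using w pi_gt_zero by simp
  qed
  have "mu_transform a_const (of_real w) + mu_transform (cnj a_const) (of_real w) =
    (LBINT t:{0<..}. of_real (mu_fun t) * exp (of_real w * (a_const - of_real (ln t))) +
       of_real (mu_fun t) * exp (of_real w * (cnj a_const - of_real (ln t))))"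
    unfolding mu_transform_def using i by (intro set_integral_add(2)[symmetric]) auto
  also have "\<dots> = (LBINT t:{0<..}. of_real (?c * (t powr (-w) * mu_fun t)))"
  proof (rule set_lebesgue_integral_cong, simp, intro allI impI)
    fix t :: real
    assume "t \<in> {0<..}"
    then have t: "t > 0" by simp
    let ?e = "exp (of_real w * (a_const - of_real (ln t)))"
    have "exp (of_real w * (cnj a_const - of_real (ln t))) = cnj ?e"
      by (simp add: exp_cnj)
    moreover have "Re ?e = exp (w * (ln (2 * pi) - ln t)) * cos (w * (pi / 2))"
      by (simp add: Re_exp a_const_def)
    moreover have "exp (w * (ln (2 * pi) - ln t)) = (2 * pi) powr w * t powr (-w)"
      using t by (simp add: powr_def algebra_simps flip: exp_add)
    ultimately show "of_real (mu_fun t) * ?e + of_real (mu_fun t) * exp (of_real w * (cnj a_const - of_real (ln t))) =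
        complex_of_real (?c * (t powr (-w) * mu_fun t))"
      by (simp only: distrib_left[symmetric] complex_add_cnj) (simp add: mult_ac)
  qed
  also have "\<dots> = of_real (LBINT t:{0<..}. ?c * (t powr (-w) * mu_fun t))"
    unfolding set_lebesgue_integral_def
    by (subst integral_complex_of_real[symmetric]) (simp add: scaleR_conv_of_real)
  also have "(LBINT t:{0<..}. ?c * (t powr (-w) * mu_fun t)) = ?c * (LBINT t:{0<..}. t powr (-w) * mu_fun t)"
    by (rule set_integral_mult_right)
  also have "\<dots> = w * (w + 1) * (\<Sum>k. 1 / real (Suc k) powr (w + 1)) * (2 * pi * ((2 * pi) powr w * (2 * pi) powr (-(w + 1))))"
    unfolding mu_fun_mellin_zeta[OF w] using cospos by (simp add: field_simps)
  also have "(2 * pi) powr w * (2 * pi) powr (-(w + 1)) = 1 / (2 * pi)"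
    unfolding powr_add[symmetric] by (simp add: powr_minus_divide)
  finally show ?thesis by simp
qed

section \<open>Analytic continuation and Taylor coefficients\<close>

lemma holomorphic_dirichlet_series:
  "(\<lambda>s. \<Sum>n. 1 / (of_nat (Suc n) :: complex) powr s) holomorphic_on {s. 1 < Re s}"
proof (rule holomorphic_uniform_sequence)
  show "open {s. 1 < Re s}" by (rule open_halfspace_Re_gt)
  show "(\<lambda>s. \<Sum>k<n. 1 / (of_nat (Suc k) :: complex) powr s) holomorphic_on {s. 1 < Re s}" for n
    by (intro holomorphic_intros) (auto simp del: of_nat_Suc)
  fix x :: complex
  assume "x \<in> {s. 1 < Re s}"
  \<comment> \<open>Half the distance to the line \<open>Re s = 1\<close>: on the closed disc
    \<open>Re s \<ge> 1 + d\<close>, which supplies the summable majorant.\<close>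
  define d where "d = (Re x - 1) / 2"
  have d: "d > 0" using \<open>x \<in> _\<close> by (simp add: d_def)
  have Re: "Re s \<ge> 1 + d" if "s \<in> cball x d" for s
  proof -
    have "Re x - Re s \<le> d"
      using that complex_Re_le_cmod[of "x - s"] by (simp add: dist_norm)
    then show ?thesis by (simp add: d_def field_simps)
  qed
  have "uniform_limit (cball x d) (\<lambda>n s. \<Sum>k<n. 1 / (of_nat (Suc k) :: complex) powr s)
      (\<lambda>s. \<Sum>k. 1 / (of_nat (Suc k) :: complex) powr s) sequentially"
  proof (rule Weierstrass_m_test)
    show "norm (1 / (of_nat (Suc n) :: complex) powr s) \<le> 1 / real (Suc n) powr (1 + d)" if "s \<in> cball x d" for n s
    proof -
      have "norm (1 / (of_nat (Suc n) :: complex) powr s) = 1 / real (Suc n) powr Re s"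
        by (simp add: norm_divide norm_powr_real_powr del: of_nat_Suc)
      also have "\<dots> \<le> 1 / real (Suc n) powr (1 + d)"
        using Re[OF that] by (intro divide_left_mono powr_mono) auto
      finally show ?thesis .
    qed
    show "summable (\<lambda>k. 1 / real (Suc k) powr (1 + d))"
      using d by (intro summable_inverse_powr_Suc) simp
  qed
  moreover have "cball x d \<subseteq> {s. 1 < Re s}"
    using Re d by force
  ultimately show "\<exists>d>0. cball x d \<subseteq> {s. 1 < Re s} \<and>
      uniform_limit (cball x d) (\<lambda>n s. \<Sum>k<n. 1 / (of_nat (Suc k) :: complex) powr s)
      (\<lambda>s. \<Sum>k. 1 / (of_nat (Suc k) :: complex) powr s) sequentially"
    using d by blast
qed

text \<open>The shift by 1 moves the half-plane of the transforms to \<open>Re s < 2\<close>, which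
  overlaps the half-plane of the Dirichlet series in a strip.\<close>

definition xi_left :: "complex \<Rightarrow> complex" where
  "xi_left s = mu_transform a_const (s - 1) + mu_transform (cnj a_const) (s - 1)"

lemma holomorphic_xi_left: "xi_left holomorphic_on {s. Re s < 2}"
proof -
  have "(\<lambda>s. mu_transform a (s - 1)) holomorphic_on {s. Re s < 2}" for a
    by (rule holomorphic_on_compose_gen[OF _ holomorphic_mu_transform, unfolded o_def])
       (auto intro!: holomorphic_intros)
  then show ?thesis
    unfolding xi_left_def[abs_def] by (intro holomorphic_intros)
qed

text \<open>Agreement on the real interval from 1 to 2 is known from the Mellin computation; since
  \<open>3/2\<close> is a limit point of it, the identity theorem extends it to the strip.\<close>

lemma xi_left_eq_dirichlet:
  assumes s: "1 < Re s" "Re s < 2"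
  shows "xi_left s = s * (s - 1) * (\<Sum>n. 1 / of_nat (Suc n) powr s)"
proof -
  let ?S = "{s. 1 < Re s} \<inter> {s. Re s < 2}"
  let ?D = "\<lambda>s::complex. s * (s - 1) * (\<Sum>n. 1 / of_nat (Suc n) powr s)"
  let ?U = "of_real ` {1<..<2 :: real} :: complex set"
  have "xi_left s - ?D s = 0"
  proof (rule analytic_continuation[where f = "\<lambda>s. xi_left s - ?D s" and S = ?S and U = ?U
        and \<xi> = "of_real (3/2)"])
    show "(\<lambda>s. xi_left s - ?D s) holomorphic_on ?S"
      by (intro holomorphic_intros holomorphic_on_subset[OF holomorphic_xi_left]
          holomorphic_on_subset[OF holomorphic_dirichlet_series]) auto
    show "open ?S"
      by (intro open_Int open_halfspace_Re_gt open_halfspace_Re_lt)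
    show "connected ?S"
      by (intro convex_connected convex_Int convex_halfspace_Re_gt convex_halfspace_Re_lt)
    show "?U \<subseteq> ?S" by auto
    show "of_real (3/2) \<in> ?S" by simp
    show "of_real (3/2) islimpt ?U"
      unfolding islimpt_approachable
    proof (intro allI impI)
      fix e :: real assume e: "e > 0"
      define x where "x = 3/2 + min (e/2) (1/4)"
      have "x \<in> {1<..<2}" "x \<noteq> 3/2" "dist x (3/2) < e"
        using e by (auto simp: x_def dist_real_def min_def)
      then show "\<exists>x'\<in>?U. x' \<noteq> of_real (3/2) \<and> dist x' (of_real (3/2)) < e"
        by (intro bexI[of _ "of_real x"] imageI conjI) (simp_all only: dist_of_real of_real_eq_iff not_False_eq_True)
    qed
    show "xi_left z - ?D z = 0" if "z \<in> ?U" for z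
    proof -
      from that obtain x where x: "1 < x" "x < 2" "z = of_real x" by auto
      have sz: "summable (\<lambda>k. 1 / real (Suc k) powr x)"
        using x by (intro summable_inverse_powr_Suc) simp
      have "1 / of_nat (Suc k) powr z = complex_of_real (1 / real (Suc k) powr x)" for k
        unfolding x(3) of_real_divide of_real_1 by (subst powr_of_real[symmetric]) simp_all
      then have "(\<Sum>n. 1 / of_nat (Suc n) powr z) = complex_of_real (\<Sum>k. 1 / real (Suc k) powr x)"
        using suminf_of_real[OF sz, where 'a = complex] by simp
      moreover have "xi_left z = of_real ((x - 1) * x * (\<Sum>k. 1 / real (Suc k) powr x))"
        using mu_transform_add_real[of "x - 1"] x by (simp add: xi_left_def)
      ultimately show ?thesis by (simp add: x(3))
    qed
    show "s \<in> ?S" using s by simp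
  qed
  then show ?thesis by simp
qed

text \<open>The definite description is justified here: gluing \<open>xi_left\<close> and the
  Dirichlet expression over the strip gives existence, and the identity theorem gives
  uniqueness.\<close>

lemma xi_entire_properties:
  "xi_entire holomorphic_on UNIV" (is ?A)
  "1 < Re s \<Longrightarrow> xi_entire s = s * (s - 1) * (\<Sum>n. 1 / of_nat (Suc n) powr s)" (is "_ \<Longrightarrow> ?B s")
proof -
  let ?D = "\<lambda>s::complex. s * (s - 1) * (\<Sum>n. 1 / of_nat (Suc n) powr s)"
  define P where "P F \<longleftrightarrow> F holomorphic_on UNIV \<and> (\<forall>s. 1 < Re s \<longrightarrow> F s = ?D s)" for F
  let ?F = "\<lambda>s. if s \<in> {s. Re s < 2} then xi_left s else ?D s"
  have "?F holomorphic_on ({s. Re s < 2} \<union> {s. 1 < Re s})"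
    using xi_left_eq_dirichlet
    by (intro holomorphic_on_If_Un holomorphic_xi_left holomorphic_intros holomorphic_dirichlet_series
        open_halfspace_Re_gt open_halfspace_Re_lt) auto
  also have "{s. Re s < 2} \<union> {s. 1 < Re s} = UNIV" by auto
  finally have "P ?F"
    using xi_left_eq_dirichlet by (auto simp: P_def)
  moreover have "F = G" if F: "P F" and G: "P G" for F G
  proof
    fix z
    have "3 \<in> {s. 1 < Re s}" by simp
    then have ne: "{s. 1 < Re s} \<noteq> {}" by blast
    show "F z = G z"
    proof (rule analytic_continuation_open[where f = F and g = G and s = "{s. 1 < Re s}" and s' = UNIV,
          OF open_halfspace_Re_gt open_UNIV ne connected_UNIV subset_UNIV])
      show "F holomorphic_on UNIV" "G holomorphic_on UNIV" using F G by (auto simp: P_def)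
      show "F s = G s" if "s \<in> {s. 1 < Re s}" for s
        using F G that by (simp add: P_def)
    qed simp
  qed
  ultimately have "\<exists>!F. P F" by blast
  then have "P (THE F. P F)" by (rule theI')
  then have "P xi_entire"
    unfolding xi_entire_def P_def[abs_def] .
  then show ?A "1 < Re s \<Longrightarrow> ?B s"
    by (simp_all add: P_def)
qed

text \<open>Both functions equal the Dirichlet expression on the strip, and the identity theorem
  carries this to the half-plane, which contains a neighbourhood of \<open>s = 1\<close>.\<close>

lemma xi_entire_eq_xi_left:
  assumes "Re s < 2"
  shows "xi_entire s = xi_left s"
proof (rule analytic_continuation_open[where s = "{s. 1 < Re s} \<inter> {s. Re s < 2}" and s' = "{s. Re s < 2}"
      and f = xi_entire and g = xi_left])
  have "3/2 \<in> {s. 1 < Re s} \<inter> {s. Re s < 2}" by simp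
  then show "{s. 1 < Re s} \<inter> {s. Re s < 2} \<noteq> {}" by blast
  show "connected {s. Re s < 2}"
    by (intro convex_connected convex_halfspace_Re_lt)
  show "xi_entire holomorphic_on {s. Re s < 2}"
    by (rule holomorphic_on_subset[OF xi_entire_properties(1)]) simp
qed (use assms xi_entire_properties(2) xi_left_eq_dirichlet in
    \<open>auto intro: holomorphic_xi_left open_halfspace_Re_gt open_halfspace_Re_lt\<close>)

theorem theorem2p2:
  fixes n :: nat
  shows "mu_coeff n = complex_of_real (2 / fact n *
           (LBINT t:{0<..}. mu_fun t * Re ((a_const - complex_of_real (ln t)) ^ n)))"
proof -
  define c where "c n = (mu_moment a_const n + mu_moment (cnj a_const) n) / fact n" for n
  have "(\<lambda>n. fps_nth (Abs_fps c) n * z ^ n) sums (xi_entire \<circ> (\<lambda>w. 1 + w)) z" if z: "norm z < 1" for z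
  proof -
    have "Re (1 + z) < 2"
      using z complex_Re_le_cmod[of z] by simp
    then have "(xi_entire \<circ> (\<lambda>w. 1 + w)) z = mu_transform a_const z + mu_transform (cnj a_const) z"
      by (simp add: xi_entire_eq_xi_left xi_left_def)
    moreover have "(\<lambda>n. mu_moment a_const n / fact n * z ^ n + mu_moment (cnj a_const) n / fact n * z ^ n) sums
        (mu_transform a_const z + mu_transform (cnj a_const) z)"
      by (intro sums_add mu_transform_sums z)
    ultimately show ?thesis
      by (simp add: c_def add_divide_distrib distrib_right)
  qed
  moreover have "eventually (\<lambda>z. z \<in> ball 0 1) (nhds (0::complex))"
    by (intro eventually_nhds_in_open) auto
  ultimately have "eventually (\<lambda>z. (\<lambda>n. fps_nth (Abs_fps c) n * z ^ n) sums (xi_entire \<circ> (\<lambda>w. 1 + w)) z) (nhds 0)"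
    by (auto elim!: eventually_mono)
  then have "(xi_entire \<circ> (\<lambda>w. 1 + w)) has_fps_expansion Abs_fps c"
    by (rule has_fps_expansionI)
  \<comment> \<open>Coefficients of a convergent expansion are derivatives at 0 over factorials; the
    shift by 1 turns these into derivatives of \<open>xi_entire\<close> at 1.\<close>
  from fps_nth_fps_expansion[OF this, of n] have "c n = mu_coeff n"
    by (simp add: mu_coeff_def higher_deriv_shift_0[of n xi_entire 1])
  then show ?thesis
    unfolding c_def mu_moment_cnj_add by simp
qed

end
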